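(* Let $q_0=(0,0,0)$ and let $q_1\in\mathcal A_2$. Then there exists an optimal trajectory from $q_0$ to $q_1$, i.e. an admissible trajectory connecting $q_0$ to $q_1$ whose length is maximal among all admissible trajectories connecting $q_0$ to $q_1$.
   Context: Let $M=\mathbb R^3$ with coordinates $(x,y,z)$, $X_1=\frac{\partial}{\partial x}$, $X_2=\frac{\partial}{\partial y}+\frac{x^2}{2}\frac{\partial}{\partial z}$, $U_2=\{(u_1,u_2)\in\mathbb R^2: u_1\ge|u_2|\}$. An admissible trajectory is a Lipschitz curve $q:[0,t_1]\to M$ ($t_1\ge0$ free) with $\dot q=u_1X_1(q)+u_2X_2(q)$ a.e. for some bounded measurable control $u:[0,t_1]\to U_2$. Its length is $l=\int_0^{t_1}\sqrt{u_1^2-u_2^2}\,dt$. $\mathcal A_2$ is the set of endpoints of admissible trajectories starting at $q_0$. *)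

theory Defs
  imports "HOL-Analysis.Analysis"
begin

type_synonym point = "real \<times> real \<times> real"

definition X1 :: "point \<Rightarrow> point" where
  "X1 = (\<lambda>(x, y, z). (1, 0, 0))"

definition X2 :: "point \<Rightarrow> point" where
  "X2 = (\<lambda>(x, y, z). (0, 1, x\<^sup>2 / 2))"

definition U2 :: "(real \<times> real) set" where
  "U2 = {(u1, u2). u1 \<ge> \<bar>u2\<bar>}"

text \<open>Curves and controls are total functions on the reals; only their values on the interval
  from 0 to \<open>t1\<close> matter.  The degenerate interval \<open>t1 = 0\<close> is allowed.  Measurability and
  null sets are with respect to Lebesgue measure.\<close>

definition admissible :: "real \<Rightarrow> (real \<Rightarrow> point) \<Rightarrow> (real \<Rightarrow> real \<times> real) \<Rightarrow> bool" where
  "admissible t1 q u \<longleftrightarrow>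
     t1 \<ge> 0 \<and>
     (\<exists>L. L-lipschitz_on {0..t1} q) \<and>
     u \<in> borel_measurable (lebesgue_on {0..t1}) \<and>
     bounded (u ` {0..t1}) \<and>
     u ` {0..t1} \<subseteq> U2 \<and>
     (AE t in lebesgue_on {0..t1}.
        (q has_vector_derivative (fst (u t) *\<^sub>R X1 (q t) + snd (u t) *\<^sub>R X2 (q t)))
          (at t within {0..t1}))"

definition connects :: "real \<Rightarrow> (real \<Rightarrow> point) \<Rightarrow> point \<Rightarrow> point \<Rightarrow> bool" where
  "connects t1 q q0 q1 \<longleftrightarrow> q 0 = q0 \<and> q t1 = q1"

text \<open>The length is written as a function of the control.  As \<open>X1\<close> and \<open>X2\<close> are linearly
  independent at every point, an admissible curve determines its control almost everywhere,
  hence its length.\<close>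

definition traj_length :: "real \<Rightarrow> (real \<Rightarrow> real \<times> real) \<Rightarrow> real" where
  "traj_length t1 u = (LINT t|lebesgue_on {0..t1}. sqrt ((fst (u t))\<^sup>2 - (snd (u t))\<^sup>2))"

definition attainable_set :: "point \<Rightarrow> point set" where
  "attainable_set q0 = {q1. \<exists>t1 q u. admissible t1 q u \<and> connects t1 q q0 q1}"

definition optimal ::
  "point \<Rightarrow> point \<Rightarrow> real \<Rightarrow> (real \<Rightarrow> point) \<Rightarrow> (real \<Rightarrow> real \<times> real) \<Rightarrow> bool" where
  "optimal q0 q1 t1 q u \<longleftrightarrow>
     admissible t1 q u \<and> connects t1 q q0 q1 \<and>
     (\<forall>t1' q' u'. admissible t1' q' u' \<and> connects t1' q' q0 q1 \<longrightarrow>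
        traj_length t1' u' \<le> traj_length t1 u)"

end

theory Submission
  imports Defs
begin

text \<open>
  Along an admissible trajectory \<open>x' = u1\<close>, \<open>y' = u2\<close> and \<open>z' = u2 x\<^sup>2 / 2\<close>.  Read with \<open>x\<close>
  as the parameter, the problem is to maximise the concave functional \<open>\<integral> sqrt (1 - v\<^sup>2) dx\<close> over
  functions \<open>v\<close> on \<open>{0..X}\<close> with values in \<open>{-1..1}\<close>, subject to two linear constraints,
  \<open>\<integral> v dx = Y\<close> and \<open>\<integral> v x\<^sup>2 / 2 dx = Z\<close>.  Existence is obtained by Lagrangian duality, so all
  compactness arguments take place in the plane of the two multipliers \<open>(a, b)\<close> and not in a
  function space.

  Put \<open>p(x) = a + b x\<^sup>2 / 2\<close>.  The reversed Cauchy-Schwarz inequality of the Minkowski plane gives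
  \<open>sqrt (u1\<^sup>2 - u2\<^sup>2) \<le> u1 sqrt (1 + p\<^sup>2) - u2 p\<close>.  Integrated along any trajectory from the origin
  to \<open>(X, Y, Z)\<close>, the right-hand side depends on the end point only, and it bounds the length by
  the dual function \<open>G(a, b) = \<integral> sqrt (1 + p\<^sup>2) dx - a Y - b Z\<close> (lemma \<open>traj_length_le_dual\<close>).

  The behaviour of \<open>G\<close> at infinity is governed by its recession function
  \<open>R(a, b) = \<integral> \<bar>p\<bar> dx - a Y - b Z\<close>, and there are two cases.

  If \<open>R\<close> is positive away from \<open>0\<close>, then \<open>G\<close> is coercive and has a minimiser
  (\<open>dual_attains_minimum\<close>).  Its stationarity (\<open>dual_stationary\<close>) says exactly that
  \<open>v = p / sqrt (1 + p\<^sup>2)\<close> satisfies both constraints, and the trajectory with control \<open>(1, v)\<close>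
  has length \<open>G(a, b)\<close> (\<open>dual_attained_by_trajectory\<close>), so it is optimal.

  If \<open>R(a, b) \<le> 0\<close> for some \<open>(a, b) \<noteq> 0\<close>, then the upper bound \<open>G(n a, n b)\<close> stays below
  an integral that tends to \<open>0\<close> as \<open>n\<close> grows, so every trajectory to \<open>(X, Y, Z)\<close> has length \<open>0\<close>
  (\<open>dual_le_zero_along_ray\<close>).  Any trajectory that witnesses attainability is then optimal.
\<close>

section \<open>Lipschitz functions as integrals of their derivatives\<close>

lemma difference_quotient_LIMSEQ:
  fixes f :: "real \<Rightarrow> real"
  assumes "(f has_real_derivative d) (at x within S)"
    and "\<forall>\<^sub>F k in sequentially. x + inverse (real (Suc k)) \<in> S"
  shows "(\<lambda>k. (f (x + inverse (real (Suc k))) - f x) / inverse (real (Suc k))) \<longlonglongrightarrow> d"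
proof -
  have "(\<lambda>k. x + inverse (real (Suc k))) \<longlonglongrightarrow> x + 0"
    by (intro tendsto_intros LIMSEQ_inverse_real_of_nat)
  then have "filterlim (\<lambda>k. x + inverse (real (Suc k))) (at x within S) sequentially"
    using assms(2) by (auto simp: filterlim_at elim!: eventually_mono)
  moreover have "((\<lambda>y. (f y - f x) / (y - x)) \<longlongrightarrow> d) (at x within S)"
    using assms(1) by (simp add: has_field_derivative_iff)
  ultimately have "(\<lambda>k. (f (x + inverse (real (Suc k))) - f x) / (x + inverse (real (Suc k)) - x))
      \<longlonglongrightarrow> d"
    by (rule filterlim_compose[rotated])
  then show ?thesis by simp
qed

text \<open>The difference quotients of \<open>f\<close> are bounded by the Lipschitz constant, so by dominated
  convergence their integrals tend to the integral of the derivative.  On the other hand the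
  integral of the difference quotient with step \<open>h\<close> telescopes to the mean of \<open>f\<close> over an interval
  of length \<open>h\<close> at \<open>b\<close> minus its mean over one at \<open>a\<close>, which tends to \<open>f b - f a\<close>.\<close>

lemma lipschitz_fundamental_theorem:
  fixes f g :: "real \<Rightarrow> real"
  assumes ab: "a \<le> b" and lip: "L-lipschitz_on {a..b} f" and N: "negligible N"
    and der: "\<And>x. x \<in> {a..b} - N \<Longrightarrow> (f has_real_derivative g x) (at x within {a..b})"
  shows "(g has_integral (f b - f a)) {a..b}"
proof -
  \<comment> \<open>The constant extension of \<open>f\<close> beyond the interval keeps the Lipschitz constant and makes the
    shifted function \<open>F (x + h)\<close> available on all of the interval.\<close>
  define F where "F x = f (max a (min b x))" for x
  define h where "h k = inverse (real (Suc k))" for k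
  define \<Phi> where "\<Phi> t = integral {a..t} F" for t
  \<comment> \<open>At \<open>b\<close> the difference quotients of \<open>F\<close> see the constant extension instead of the derivative
    of \<open>f\<close>, so this point joins the exceptional set.\<close>
  define M where "M = insert b N"
  define D where "D k x = (if x \<in> M then 0 else (F (x + h k) - F x) / h k)" for k x
  define g' where "g' x = (if x \<in> M then 0 else g x)" for x
  have h: "h k > 0" "h k \<le> 1" for k
    by (simp_all add: h_def inverse_le_1_iff)
  have h0: "h \<longlonglongrightarrow> 0"
    unfolding h_def by (rule LIMSEQ_inverse_real_of_nat)
  have negM: "negligible M" unfolding M_def using N by simp
  have L0: "L \<ge> 0" using lip by (rule lipschitz_on_nonneg)
  have lipF: "\<bar>F x - F y\<bar> \<le> L * \<bar>x - y\<bar>" for x y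
  proof -
    have "\<bar>F x - F y\<bar> \<le> L * \<bar>max a (min b x) - max a (min b y)\<bar>"
      using lipschitz_onD[OF lip, of "max a (min b x)" "max a (min b y)"] ab
      by (simp add: F_def dist_real_def)
    also have "\<dots> \<le> L * \<bar>x - y\<bar>"
      by (intro mult_left_mono L0) linarith
    finally show ?thesis .
  qed
  have contF: "continuous_on S F" for S
  proof -
    have "L-lipschitz_on S F"
      using lipF L0 by (intro lipschitz_onI) (auto simp: dist_real_def)
    then show ?thesis by (rule lipschitz_on_continuous_on)
  qed
  have intF: "F integrable_on {c..d}" for c d
    by (rule integrable_continuous_real[OF contF])
  have lim\<Phi>: "(\<lambda>k. (\<Phi> (x + h k) - \<Phi> x) / h k) \<longlonglongrightarrow> F x" if "x \<in> {a..b}" for x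
  proof -
    have "(\<Phi> has_real_derivative F x) (at x within {a..b+1})"
      using integral_has_vector_derivative[OF contF, of x a "b+1"] that
      by (simp add: has_real_derivative_iff_has_vector_derivative \<Phi>_def[abs_def])
    moreover have "x + inverse (real (Suc k)) \<in> {a..b+1}" for k
      using h[of k] that unfolding h_def atLeastAtMost_iff by linarith
    ultimately show ?thesis
      unfolding h_def by (intro difference_quotient_LIMSEQ) auto
  qed
  have intD: "(D k has_integral ((\<Phi> (b + h k) - \<Phi> b) / h k - (\<Phi> (a + h k) - \<Phi> a) / h k)) {a..b}"
    for k
  proof -
    have "(F has_integral integral {a + h k..b + h k} F) (cbox (a + h k) (b + h k))"
      using integrable_integral[OF intF] by simp
    from has_integral_affinity[OF this, of 1 "h k"]
    have "((\<lambda>x. F (x + h k)) has_integral integral {a + h k..b + h k} F) {a..b}"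
      by (simp add: image_add_atLeastAtMost')
    moreover have "integral {a + h k..b + h k} F = \<Phi> (b + h k) - \<Phi> (a + h k)"
      using Henstock_Kurzweil_Integration.integral_combine[OF _ _ intF, of a "a + h k" "b + h k"]
        h[of k] ab
      by (simp add: \<Phi>_def)
    ultimately have "((\<lambda>x. F (x + h k)) has_integral (\<Phi> (b + h k) - \<Phi> (a + h k))) {a..b}"
      by simp
    moreover have "(F has_integral \<Phi> b) {a..b}"
      unfolding \<Phi>_def by (rule integrable_integral[OF intF])
    ultimately have "((\<lambda>x. F (x + h k) - F x) has_integral
        (\<Phi> (b + h k) - \<Phi> (a + h k) - \<Phi> b)) {a..b}"
      by (rule has_integral_diff)
    note quotient = has_integral_divide[OF this, of "h k"]
    have "(\<Phi> (b + h k) - \<Phi> (a + h k) - \<Phi> b) / h k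
        = (\<Phi> (b + h k) - \<Phi> b) / h k - (\<Phi> (a + h k) - \<Phi> a) / h k"
      by (simp add: \<Phi>_def flip: diff_divide_distrib)
    note quotient[unfolded this]
    then show ?thesis
      by (rule has_integral_spike[OF negM, rotated]) (simp add: D_def)
  qed
  have limD: "(\<lambda>k. D k x) \<longlonglongrightarrow> g' x" if x: "x \<in> {a..b}" for x
  proof (cases "x \<in> M")
    case True
    then show ?thesis by (simp add: D_def g'_def)
  next
    case False
    then have xb: "x < b" and xN: "x \<notin> N" using x by (auto simp: M_def)
    have "\<forall>\<^sub>F k in sequentially. h k < b - x"
      using order_tendstoD(2)[OF h0, of "b - x"] xb by simp
    then have ev: "\<forall>\<^sub>F k in sequentially. x + h k \<in> {a..b}"
      by eventually_elim (use x h(1) in \<open>force simp: less_imp_le intro: add_increasing2\<close>)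
    then have "(\<lambda>k. (f (x + h k) - f x) / h k) \<longlonglongrightarrow> g x"
      unfolding h_def using der x xN by (intro difference_quotient_LIMSEQ) auto
    moreover have "\<forall>\<^sub>F k in sequentially. (f (x + h k) - f x) / h k = D k x"
      using ev by eventually_elim (use x False in \<open>auto simp: D_def F_def\<close>)
    ultimately show ?thesis
      using False by (auto simp: g'_def intro: Lim_transform_eventually)
  qed
  have bd: "norm (D k x) \<le> L" for k x
  proof -
    have "\<bar>F (x + h k) - F x\<bar> \<le> L * h k" using lipF[of "x + h k" x] h(1)[of k] by simp
    then have "\<bar>(F (x + h k) - F x) / h k\<bar> \<le> L"
      using h(1)[of k] by (simp add: abs_divide pos_divide_le_eq)
    then show ?thesis using L0 by (simp add: D_def)
  qed
  have int_g': "g' integrable_on {a..b}"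
    and lim: "(\<lambda>k. integral {a..b} (D k)) \<longlonglongrightarrow> integral {a..b} g'"
    using dominated_convergence[of D "{a..b}" "\<lambda>_. L" g'] intD bd limD
    by (auto simp: has_integral_integrable)
  have "(\<lambda>k. integral {a..b} (D k)) \<longlonglongrightarrow> F b - F a"
    using tendsto_diff[OF lim\<Phi>[of b] lim\<Phi>[of a]] ab integral_unique[OF intD] by simp
  then have "integral {a..b} g' = f b - f a"
    using LIMSEQ_unique[OF lim] ab by (simp add: F_def)
  then have "(g' has_integral (f b - f a)) {a..b}"
    using int_g' by (metis integrable_integral)
  then show ?thesis
    by (rule has_integral_spike[OF negM, rotated]) (simp add: g'_def)
qed

text \<open>The form in which the fundamental theorem is applied: a pointwise lower bound on the derivative,
  known almost everywhere for Lebesgue measure, integrates to a lower bound on the increment.\<close>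

lemma lipschitz_increment_ge_integral:
  fixes f g :: "real \<Rightarrow> real"
  assumes ab: "a \<le> b" and lip: "L-lipschitz_on {a..b} f" and g: "g integrable_on {a..b}"
    and der: "AE t in lebesgue_on {a..b}. \<exists>d\<ge>g t. (f has_real_derivative d) (at t within {a..b})"
  shows "integral {a..b} g \<le> f b - f a"
proof -
  have "AE t in lebesgue. t \<in> {a..b} \<longrightarrow>
      (\<exists>d\<ge>g t. (f has_real_derivative d) (at t within {a..b}))"
    using der by (subst (asm) AE_restrict_space_iff) auto
  then obtain N where N: "N \<in> null_sets lebesgue"
    and NP: "{t. \<not> (t \<in> {a..b} \<longrightarrow>
      (\<exists>d\<ge>g t. (f has_real_derivative d) (at t within {a..b})))} \<subseteq> N"
    by (auto simp: eventually_ae_filter)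
  have negN: "negligible N" using N by (simp add: negligible_iff_null_sets)
  have "\<exists>d. \<forall>t\<in>{a..b} - N. g t \<le> d t \<and> (f has_real_derivative d t) (at t within {a..b})"
    using NP by (intro bchoice) blast
  then obtain d where d: "\<forall>t\<in>{a..b} - N.
      g t \<le> d t \<and> (f has_real_derivative d t) (at t within {a..b})" ..
  \<comment> \<open>Outside its domain of validity \<open>d\<close> is arbitrary; this version dominates \<open>g\<close> everywhere.\<close>
  define d' where "d' t = (if t \<in> N then g t else d t)" for t
  have "(d has_integral (f b - f a)) {a..b}"
    by (rule lipschitz_fundamental_theorem[OF ab lip negN]) (rule d[rule_format, THEN conjunct2])
  then have "(d' has_integral (f b - f a)) {a..b}"
    by (rule has_integral_spike[OF negN, rotated]) (simp add: d'_def)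
  moreover have "g t \<le> d' t" if "t \<in> {a..b}" for t
    using d[rule_format, THEN conjunct1, of t] that by (simp add: d'_def)
  ultimately show ?thesis
    by (rule has_integral_le[OF integrable_integral[OF g]])
qed

lemma continuous_on_interval_boundedE:
  fixes f :: "real \<Rightarrow> 'a::real_normed_vector"
  assumes "continuous_on {a..b} f"
  obtains C where "\<And>t. t \<in> {a..b} \<Longrightarrow> norm (f t) \<le> C"
proof -
  have "bounded (f ` {a..b})"
    by (intro compact_imp_bounded compact_continuous_image assms) simp
  then obtain C where "\<forall>y\<in>f ` {a..b}. norm y \<le> C"
    unfolding bounded_iff ..
  then show ?thesis
    by (intro that[of C]) simp
qed

lemma continuously_differentiable_imp_lipschitz:
  fixes f f' :: "real \<Rightarrow> 'a::real_normed_vector"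
  assumes der: "\<And>t. t \<in> {a..b} \<Longrightarrow> (f has_vector_derivative f' t) (at t within {a..b})"
    and cont: "continuous_on {a..b} f'"
  shows "\<exists>C. C-lipschitz_on {a..b} f"
proof -
  obtain C where C: "\<And>t. t \<in> {a..b} \<Longrightarrow> norm (f' t) \<le> C"
    by (rule continuous_on_interval_boundedE[OF cont]) (rule that)
  have "\<bar>C\<bar>-lipschitz_on {a..b} f"
  proof (rule bounded_derivative_imp_lipschitz)
    show "(f has_derivative (\<lambda>h. h *\<^sub>R f' t)) (at t within {a..b})" if "t \<in> {a..b}" for t
      using der[OF that] by (simp add: has_vector_derivative_def)
    show "onorm (\<lambda>h. h *\<^sub>R f' t) \<le> \<bar>C\<bar>" if "t \<in> {a..b}" for t
    proof (rule onorm_le)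
      fix h :: real
      have "norm (f' t) \<le> \<bar>C\<bar>" using C[OF that] by linarith
      then show "norm (h *\<^sub>R f' t) \<le> \<bar>C\<bar> * norm h"
        using mult_right_mono[of "norm (f' t)" "\<bar>C\<bar>" "\<bar>h\<bar>"] by (simp add: mult.commute)
    qed
  qed (rule convex_real_interval, rule abs_ge_zero)
  then show ?thesis by (rule exI)
qed

section \<open>The dual function of the optimal control problem\<close>

text \<open>The causal vector \<open>(w, v)\<close> is paired with the unit timelike vector \<open>(sqrt (1 + p\<^sup>2), p)\<close>; in
  the Minkowski plane such a pairing is at least the product of the lengths.  Equality holds
  when \<open>v / w = p / sqrt (1 + p\<^sup>2)\<close>.\<close>

lemma reverse_Cauchy_Schwarz:
  fixes v w p :: real
  assumes "\<bar>v\<bar> \<le> w"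
  shows "sqrt (w\<^sup>2 - v\<^sup>2) \<le> w * sqrt (1 + p\<^sup>2) - v * p"
proof (rule real_le_lsqrt)
  have "v * p \<le> \<bar>v\<bar> * \<bar>p\<bar>" by (metis abs_ge_self abs_mult)
  also have "\<dots> \<le> w * sqrt (1 + p\<^sup>2)"
    using assms by (intro mult_mono real_le_rsqrt) auto
  finally show "0 \<le> w * sqrt (1 + p\<^sup>2) - v * p" by simp
  have "(w * sqrt (1 + p\<^sup>2) - v * p)\<^sup>2 - (w\<^sup>2 - v\<^sup>2)
      = w\<^sup>2 * (sqrt (1 + p\<^sup>2))\<^sup>2 - 2 * w * v * p * sqrt (1 + p\<^sup>2) + v\<^sup>2 * (1 + p\<^sup>2) - w\<^sup>2"
    by (simp add: power2_eq_square algebra_simps)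
  also have "\<dots> = (w * p - v * sqrt (1 + p\<^sup>2))\<^sup>2"
    by (simp add: power2_diff power_mult_distrib algebra_simps)
  also have "\<dots> \<ge> 0" by simp
  finally show "w\<^sup>2 - v\<^sup>2 \<le> (w * sqrt (1 + p\<^sup>2) - v * p)\<^sup>2" by simp
qed

text \<open>The second derivative of \<open>sqrt (1 + p\<^sup>2)\<close> is at most \<open>1\<close>.  This uniform quadratic bound yields the
  stationarity condition without differentiating under the integral sign.\<close>

lemma sqrt_one_plus_square_upper_parabola:
  fixes p k :: real
  shows "sqrt (1 + (p + k)\<^sup>2) \<le> sqrt (1 + p\<^sup>2) + k * (p / sqrt (1 + p\<^sup>2)) + k\<^sup>2 / 2"
proof -
  define s where "s = sqrt (1 + p\<^sup>2)"
  have s1: "s \<ge> 1" and s2: "s\<^sup>2 = 1 + p\<^sup>2" by (simp_all add: s_def)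
  define r where "r = sqrt (1 + (p + k)\<^sup>2)"
  have r2: "r\<^sup>2 = 1 + (p + k)\<^sup>2" by (simp add: r_def)
  have "2 * (r * s) \<le> r\<^sup>2 + s\<^sup>2"
    using sum_squares_ge_zero[of "r - s" 0] by (simp add: power2_eq_square algebra_simps)
  also have "\<dots> = 2 * s\<^sup>2 + 2 * k * p + k\<^sup>2"
    using r2 s2 by (simp add: power2_eq_square algebra_simps)
  also have "\<dots> \<le> 2 * s\<^sup>2 + 2 * k * p + s * k\<^sup>2"
    using s1 mult_right_mono[of 1 s "k\<^sup>2"] by simp
  finally have "r * s \<le> (s + k * (p / s) + k\<^sup>2 / 2) * s"
    using s1 by (simp add: power2_eq_square algebra_simps)
  then have "r \<le> s + k * (p / s) + k\<^sup>2 / 2" using s1 by simp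
  then show ?thesis by (simp add: r_def s_def)
qed

text \<open>The covector \<open>(a, b)\<close> paired with the constraint densities \<open>(1, x\<^sup>2 / 2)\<close> of \<open>y\<close> and \<open>z\<close>.\<close>

definition multiplier :: "real \<Rightarrow> real \<Rightarrow> real \<Rightarrow> real" where
  "multiplier a b x = a + b * (x\<^sup>2 / 2)"

definition dual_function :: "real \<Rightarrow> real \<Rightarrow> real \<Rightarrow> real \<Rightarrow> real \<Rightarrow> real" where
  "dual_function X Y Z a b = integral {0..X} (\<lambda>x. sqrt (1 + (multiplier a b x)\<^sup>2)) - (a * Y + b * Z)"

text \<open>The limit of \<open>dual_function X Y Z (t * a) (t * b) / t\<close> as \<open>t\<close> tends to infinity.\<close>

definition recession_function :: "real \<Rightarrow> real \<Rightarrow> real \<Rightarrow> real \<Rightarrow> real \<Rightarrow> real" where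
  "recession_function X Y Z a b = integral {0..X} (\<lambda>x. \<bar>multiplier a b x\<bar>) - (a * Y + b * Z)"

lemma continuous_on_multiplier [continuous_intros]:
  assumes "continuous_on S f" "continuous_on S g" "continuous_on S h"
  shows "continuous_on S (\<lambda>x. multiplier (f x) (g x) (h x))"
  unfolding multiplier_def by (intro continuous_intros assms) simp

lemma one_plus_square_pos: "0 < 1 + (p::real)\<^sup>2"
  by (simp add: add_pos_nonneg)

lemma one_plus_square_nonzero [simp]: "1 + (p::real)\<^sup>2 \<noteq> 0"
  using one_plus_square_pos[of p] by linarith

section \<open>The dual function bounds the length of every trajectory\<close>

lemma admissible_components:
  assumes "admissible T q u"
  defines "x \<equiv> \<lambda>t. fst (q t)" and "y \<equiv> \<lambda>t. fst (snd (q t))" and "z \<equiv> \<lambda>t. snd (snd (q t))"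
  shows "\<exists>L. L-lipschitz_on {0..T} x \<and> L-lipschitz_on {0..T} y \<and> L-lipschitz_on {0..T} z"
    and "AE t in lebesgue_on {0..T}.
      (x has_real_derivative fst (u t)) (at t within {0..T}) \<and>
      (y has_real_derivative snd (u t)) (at t within {0..T}) \<and>
      (z has_real_derivative snd (u t) * ((x t)\<^sup>2 / 2)) (at t within {0..T}) \<and>
      \<bar>snd (u t)\<bar> \<le> fst (u t)"
proof -
  obtain L where "L-lipschitz_on {0..T} q" using assms(1) by (auto simp: admissible_def)
  then have "L-lipschitz_on {0..T} x \<and> L-lipschitz_on {0..T} y \<and> L-lipschitz_on {0..T} z"
    unfolding lipschitz_on_def x_def y_def z_def
    by (meson dist_fst_le dist_snd_le order_trans)
  then show "\<exists>L. L-lipschitz_on {0..T} x \<and> L-lipschitz_on {0..T} y \<and> L-lipschitz_on {0..T} z"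
    by blast
  have U: "\<bar>snd (u t)\<bar> \<le> fst (u t)" if "t \<in> {0..T}" for t
    using assms(1) that by (force simp: admissible_def U2_def image_subset_iff split: prod.splits)
  have "AE t in lebesgue_on {0..T}.
      (q has_vector_derivative (fst (u t) *\<^sub>R X1 (q t) + snd (u t) *\<^sub>R X2 (q t))) (at t within {0..T})"
    using assms(1) by (simp add: admissible_def)
  moreover have "AE t in lebesgue_on {0..T}. t \<in> {0..T}"
    using AE_space[of "lebesgue_on {0..T}"] by simp
  ultimately show "AE t in lebesgue_on {0..T}.
      (x has_real_derivative fst (u t)) (at t within {0..T}) \<and>
      (y has_real_derivative snd (u t)) (at t within {0..T}) \<and>
      (z has_real_derivative snd (u t) * ((x t)\<^sup>2 / 2)) (at t within {0..T}) \<and>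
      \<bar>snd (u t)\<bar> \<le> fst (u t)"
  proof eventually_elim
    case (elim t)
    note d = elim(1)
    note d1 = bounded_linear.has_vector_derivative[OF bounded_linear_fst d]
    note d2 = bounded_linear.has_vector_derivative[OF bounded_linear_snd d]
    note d3 = bounded_linear.has_vector_derivative[OF bounded_linear_fst d2]
    note d4 = bounded_linear.has_vector_derivative[OF bounded_linear_snd d2]
    show ?case
      using d1 d3 d4 U[OF elim(2)]
      by (simp add: has_real_derivative_iff_has_vector_derivative x_def y_def z_def
          X1_def X2_def split_beta)
  qed
qed

lemma traj_length_integral:
  assumes adm: "admissible T q u"
  shows "(\<lambda>t. sqrt ((fst (u t))\<^sup>2 - (snd (u t))\<^sup>2)) integrable_on {0..T}"
    and "traj_length T u = integral {0..T} (\<lambda>t. sqrt ((fst (u t))\<^sup>2 - (snd (u t))\<^sup>2))"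
proof -
  let ?g = "\<lambda>t. sqrt ((fst (u t))\<^sup>2 - (snd (u t))\<^sup>2)"
  have meas: "u \<in> borel_measurable (lebesgue_on {0..T})" using adm by (simp add: admissible_def)
  obtain B where B: "\<And>t. t \<in> {0..T} \<Longrightarrow> norm (u t) \<le> B"
    using adm unfolding admissible_def bounded_iff by blast
  have "norm (?g t) \<le> B" if "t \<in> {0..T}" for t
  proof -
    have "\<bar>snd (u t)\<bar> \<le> fst (u t)"
      using adm that by (force simp: admissible_def U2_def image_subset_iff split: prod.splits)
    then have "(snd (u t))\<^sup>2 \<le> (fst (u t))\<^sup>2" and "0 \<le> fst (u t)"
      using power_mono[of "\<bar>snd (u t)\<bar>" "fst (u t)" 2] by auto
    then have "\<bar>?g t\<bar> \<le> fst (u t)" by (auto intro: real_le_lsqrt)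
    also have "\<dots> \<le> norm (u t)" using norm_fst_le[of "fst (u t)" "snd (u t)"] by simp
    finally show ?thesis using B[OF that] by simp
  qed
  then have bd: "AE t in lebesgue_on {0..T}. norm (?g t) \<le> B"
    by (intro AE_I2) simp
  have "(\<lambda>t. fst (u t)) \<in> borel_measurable (lebesgue_on {0..T})"
    and "(\<lambda>t. snd (u t)) \<in> borel_measurable (lebesgue_on {0..T})"
    using measurable_compose[OF meas borel_measurable_continuous_onI[OF continuous_on_fst[OF continuous_on_id]]]
      measurable_compose[OF meas borel_measurable_continuous_onI[OF continuous_on_snd[OF continuous_on_id]]]
    by simp_all
  then have "?g \<in> borel_measurable (lebesgue_on {0..T})" by measurable
  moreover have "finite_measure (lebesgue_on {0..T})"
    by (intro finite_measure_lebesgue_on) simp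
  ultimately have "integrable (lebesgue_on {0..T}) ?g"
    by (intro finite_measure.integrable_const_bound[OF _ bd])
  then show "?g integrable_on {0..T}" and "traj_length T u = integral {0..T} ?g"
    by (simp_all add: traj_length_def lebesgue_integral_eq_integral integrable_on_lebesgue_on)
qed

lemma admissible_x_mono:
  assumes adm: "admissible T q u"
  shows "fst (q 0) \<le> fst (q T)"
proof -
  obtain L where L: "L-lipschitz_on {0..T} (\<lambda>t. fst (q t))"
    using admissible_components(1)[OF adm] by blast
  have "AE t in lebesgue_on {0..T}.
      \<exists>d\<ge>0. ((\<lambda>t. fst (q t)) has_real_derivative d) (at t within {0..T})"
    using admissible_components(2)[OF adm]
  proof eventually_elim
    case (elim t)
    then show ?case by (intro exI[of _ "fst (u t)"]) auto
  qed
  then have "integral {0..T} (\<lambda>_. 0) \<le> fst (q T) - fst (q 0)"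
    using adm by (intro lipschitz_increment_ge_integral[OF _ L]) (auto simp: admissible_def)
  then show ?thesis by simp
qed

text \<open>Let \<open>H\<close> be a primitive of \<open>sqrt (1 + p\<^sup>2)\<close>.  The function \<open>H (x t) - a y t - b z t\<close> is Lipschitz,
  its derivative \<open>u1 sqrt (1 + p\<^sup>2) - u2 p\<close> dominates the length integrand by the reversed
  Cauchy-Schwarz inequality, and its increment is the value of the dual function.\<close>

lemma traj_length_le_dual:
  assumes adm: "admissible T q u" and con: "connects T q (0, 0, 0) (X, Y, Z)"
  shows "traj_length T u \<le> dual_function X Y Z a b"
proof -
  define x where "x t = fst (q t)" for t
  define y where "y t = fst (snd (q t))" for t
  define z where "z t = snd (snd (q t))" for t
  have T: "0 \<le> T" using adm by (simp add: admissible_def)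
  have ends: "x 0 = 0" "y 0 = 0" "z 0 = 0" "x T = X" "y T = Y" "z T = Z"
    using con by (auto simp: connects_def x_def y_def z_def)
  have X: "0 \<le> X" using admissible_x_mono[OF adm] ends by (simp add: x_def)
  obtain L where lx: "L-lipschitz_on {0..T} x" and ly: "L-lipschitz_on {0..T} y"
    and lz: "L-lipschitz_on {0..T} z"
    using admissible_components(1)[OF adm] unfolding x_def[abs_def] y_def[abs_def] z_def[abs_def]
    by blast
  obtain B where B: "\<And>t. t \<in> {0..T} \<Longrightarrow> norm (x t) \<le> B"
    by (rule continuous_on_interval_boundedE[OF lipschitz_on_continuous_on[OF lx]]) (rule that)
  \<comment> \<open>The primitive is taken on a symmetric interval that contains the whole range of \<open>x\<close>.\<close>
  have xB: "x ` {0..T} \<subseteq> {-B..B}"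
  proof
    fix \<xi> assume "\<xi> \<in> x ` {0..T}"
    then obtain t where "t \<in> {0..T}" "\<xi> = x t" by blast
    with B[of t] show "\<xi> \<in> {-B..B}" by (simp add: abs_le_iff)
  qed
  let ?w = "\<lambda>\<xi>. sqrt (1 + (multiplier a b \<xi>)\<^sup>2)"
  have contw: "continuous_on S ?w" for S by (intro continuous_intros)
  obtain H where H: "\<And>\<xi>. \<xi> \<in> {-B..B} \<Longrightarrow> (H has_vector_derivative ?w \<xi>) (at \<xi> within {-B..B})"
    by (rule antiderivative_continuous[OF contw]) (rule that)
  have "\<exists>C. C-lipschitz_on {-B..B} H"
    by (rule continuously_differentiable_imp_lipschitz[OF H contw])
  then obtain C where "C-lipschitz_on {-B..B} H" ..
  then have lH: "C-lipschitz_on (x ` {0..T}) H"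
    by (rule lipschitz_on_subset[OF _ xB])
  define F where "F t = H (x t) - (a * y t + b * z t)" for t
  have "\<exists>K. K-lipschitz_on {0..T} F"
    unfolding F_def[abs_def]
    by (rule exI, rule lipschitz_on_diff[OF lipschitz_on_compose2[OF lx lH]
        lipschitz_on_add[OF lipschitz_on_cmult_real[OF ly] lipschitz_on_cmult_real[OF lz]]])
  then obtain K where K: "K-lipschitz_on {0..T} F" ..
  have "AE t in lebesgue_on {0..T}. t \<in> {0..T}"
    using AE_space[of "lebesgue_on {0..T}"] by simp
  with admissible_components(2)[OF adm]
  have der: "AE t in lebesgue_on {0..T}. \<exists>d\<ge>sqrt ((fst (u t))\<^sup>2 - (snd (u t))\<^sup>2).
      (F has_real_derivative d) (at t within {0..T})"
  proof eventually_elim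
    case (elim t)
    let ?d = "fst (u t) * ?w (x t) - (a * snd (u t) + b * (snd (u t) * ((x t)\<^sup>2 / 2)))"
    have dx: "(x has_vector_derivative fst (u t)) (at t within {0..T})"
      using elim by (simp add: x_def[abs_def] has_real_derivative_iff_has_vector_derivative)
    have xt: "x t \<in> {-B..B}" using xB elim by blast
    have dH: "(H has_vector_derivative ?w (x t)) (at (x t) within x ` {0..T})"
      using H[OF xt] xB by (rule has_vector_derivative_within_subset)
    have "((H \<circ> x) has_real_derivative fst (u t) * ?w (x t)) (at t within {0..T})"
      using vector_diff_chain_within[OF dx dH]
      by (simp add: has_real_derivative_iff_has_vector_derivative)
    then have "(F has_real_derivative ?d) (at t within {0..T})"
      unfolding F_def[abs_def] o_def using elim
      by (intro DERIV_diff DERIV_add DERIV_cmult)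
        (auto simp: x_def[abs_def] y_def[abs_def] z_def[abs_def])
    moreover have "sqrt ((fst (u t))\<^sup>2 - (snd (u t))\<^sup>2)
        \<le> fst (u t) * ?w (x t) - snd (u t) * multiplier a b (x t)"
      using elim by (intro reverse_Cauchy_Schwarz) simp
    moreover have "snd (u t) * multiplier a b (x t)
        = a * snd (u t) + b * (snd (u t) * ((x t)\<^sup>2 / 2))"
      by (simp add: multiplier_def algebra_simps)
    ultimately show ?case by (intro exI[of _ ?d]) simp
  qed
  have "traj_length T u \<le> F T - F 0"
    unfolding traj_length_integral(2)[OF adm]
    by (rule lipschitz_increment_ge_integral[OF T K traj_length_integral(1)[OF adm] der])
  also have "\<dots> = H X - H 0 - (a * Y + b * Z)" by (simp add: F_def ends)
  also have "H X - H 0 = integral {0..X} ?w"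
  proof -
    have "T \<in> {0..T}" using T by simp
    from B[OF this] have "\<bar>X\<bar> \<le> B" by (simp only: ends real_norm_def)
    then have B0: "X \<le> B" "- B \<le> 0" using X by linarith+
    have "(?w has_integral (H X - H 0)) {0..X}"
    proof (rule fundamental_theorem_of_calculus[OF X])
      fix \<xi> assume "\<xi> \<in> {0..X}"
      then show "(H has_vector_derivative ?w \<xi>) (at \<xi> within {0..X})"
        using B0 by (intro has_vector_derivative_within_subset[OF H]) auto
    qed
    then show ?thesis by (simp add: integral_unique)
  qed
  finally show ?thesis by (simp add: dual_function_def)
qed

section \<open>A stationary point of the dual function gives an optimal trajectory\<close>

text \<open>The two integral conditions are the vanishing of the gradient of the dual function.  They make
  the trajectory with control \<open>(1, v)\<close>, \<open>v = p / sqrt (1 + p\<^sup>2)\<close>, end at \<open>(X, Y, Z)\<close>.  This control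
  is the case of equality in the reversed Cauchy-Schwarz inequality.\<close>

lemma dual_attained_by_trajectory:
  assumes X: "0 \<le> X"
    and Y: "integral {0..X} (\<lambda>x. multiplier a b x / sqrt (1 + (multiplier a b x)\<^sup>2)) = Y"
    and Z: "integral {0..X} (\<lambda>x. multiplier a b x / sqrt (1 + (multiplier a b x)\<^sup>2) * (x\<^sup>2 / 2)) = Z"
  shows "\<exists>q u. admissible X q u \<and> connects X q (0, 0, 0) (X, Y, Z) \<and>
    traj_length X u = dual_function X Y Z a b"
proof -
  define v where "v x = multiplier a b x / sqrt (1 + (multiplier a b x)\<^sup>2)" for x
  define q where "q t = (t, integral {0..t} v, integral {0..t} (\<lambda>x. v x * (x\<^sup>2 / 2)))" for t
  define u where "u t = (1::real, v t)" for t
  have contv: "continuous_on S v" for S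
    unfolding v_def[abs_def] by (intro continuous_intros) auto
  have v1: "\<bar>v x\<bar> \<le> 1" for x
    unfolding v_def abs_divide by (simp add: one_plus_square_pos real_le_rsqrt)
  have dq: "(q has_vector_derivative (1, v t, v t * (t\<^sup>2 / 2))) (at t within {0..X})"
    if "t \<in> {0..X}" for t
    unfolding q_def[abs_def]
    by (intro has_vector_derivative_Pair integral_has_vector_derivative that continuous_intros contv)
      (auto intro!: derivative_eq_intros)
  have "continuous_on {0..X} (\<lambda>t. (1::real, v t, v t * (t\<^sup>2 / 2)))"
    by (intro continuous_intros contv) auto
  from dq this have "\<exists>C. C-lipschitz_on {0..X} q"
    by (rule continuously_differentiable_imp_lipschitz)
  moreover have "u \<in> borel_measurable (lebesgue_on {0..X})"
    unfolding u_def[abs_def]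
    by (intro continuous_imp_measurable_on_sets_lebesgue continuous_intros contv) auto
  moreover have "bounded (u ` {0..X})"
    unfolding u_def[abs_def]
    by (intro compact_imp_bounded compact_continuous_image continuous_intros contv) auto
  moreover have "u ` {0..X} \<subseteq> U2" using v1 by (auto simp: u_def U2_def)
  moreover have "AE t in lebesgue_on {0..X}.
      (q has_vector_derivative (fst (u t) *\<^sub>R X1 (q t) + snd (u t) *\<^sub>R X2 (q t))) (at t within {0..X})"
    using dq by (intro AE_I2) (simp add: u_def X1_def X2_def q_def)
  ultimately have adm: "admissible X q u"
    using X by (simp add: admissible_def)
  moreover have "connects X q (0, 0, 0) (X, Y, Z)"
    using Y Z by (simp add: connects_def q_def v_def[abs_def])
  moreover have "traj_length X u = dual_function X Y Z a b"
  proof -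
    let ?s = "\<lambda>x. sqrt (1 + (multiplier a b x)\<^sup>2)"
    have eq: "sqrt ((fst (u t))\<^sup>2 - (snd (u t))\<^sup>2)
        = ?s t - (a * v t + b * (v t * (t\<^sup>2 / 2)))" for t
    proof -
      define p where "p = multiplier a b t"
      define s where "s = sqrt (1 + p\<^sup>2)"
      have s: "s > 0" "s\<^sup>2 = 1 + p\<^sup>2" by (simp_all add: s_def one_plus_square_pos)
      have "1 - (p / s)\<^sup>2 = (1 / s)\<^sup>2"
        using s by (simp add: power_divide field_simps)
      then have "sqrt (1 - (p / s)\<^sup>2) = 1 / s" using s(1) by (simp add: real_sqrt_divide)
      also have "\<dots> = s - p / s * p"
        using s by (simp add: field_simps power2_eq_square)
      finally have "sqrt (1 - (v t)\<^sup>2) = ?s t - v t * multiplier a b t"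
        by (simp add: v_def p_def s_def)
      then show ?thesis by (simp add: u_def multiplier_def algebra_simps)
    qed
    have "traj_length X u = integral {0..X} (\<lambda>t. ?s t - (a * v t + b * (v t * (t\<^sup>2 / 2))))"
      unfolding traj_length_integral(2)[OF adm] eq ..
    also have "\<dots> = integral {0..X} ?s - (a * integral {0..X} v
        + b * integral {0..X} (\<lambda>t. v t * (t\<^sup>2 / 2)))"
      by (intro integral_unique has_integral_diff has_integral_add has_integral_mult_right
          integrable_integral integrable_continuous_real continuous_intros contv) simp_all
    finally show ?thesis using Y Z by (simp add: dual_function_def v_def[abs_def])
  qed
  ultimately show ?thesis by blast
qed

text \<open>The left-hand side minus the right-hand side is the derivative \<open>D\<close> of the dual function in the
  direction \<open>(\<alpha>, \<beta>)\<close>.  Minimality and the quadratic upper bound on \<open>sqrt (1 + p\<^sup>2)\<close> give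
  \<open>0 \<le> h D + h\<^sup>2 C\<close> for every \<open>h\<close>, which forces \<open>D = 0\<close>.\<close>

lemma dual_stationary:
  fixes a b \<alpha> \<beta> :: real
  assumes min: "\<And>a' b'. dual_function X Y Z a b \<le> dual_function X Y Z a' b'"
  shows "integral {0..X} (\<lambda>x. multiplier a b x / sqrt (1 + (multiplier a b x)\<^sup>2) * multiplier \<alpha> \<beta> x)
    = \<alpha> * Y + \<beta> * Z"
proof -
  let ?p = "multiplier a b" and ?m = "multiplier \<alpha> \<beta>"
  let ?s = "\<lambda>x. sqrt (1 + (?p x)\<^sup>2)" and ?v = "\<lambda>x. ?p x / sqrt (1 + (?p x)\<^sup>2) * ?m x"
  let ?c = "\<lambda>x. (?m x)\<^sup>2 / 2"
  define D where "D = integral {0..X} ?v - (\<alpha> * Y + \<beta> * Z)"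
  define C where "C = integral {0..X} ?c"
  have ints: "?s integrable_on {0..X}" and intv: "?v integrable_on {0..X}"
    and intc: "?c integrable_on {0..X}"
    by (auto intro!: integrable_continuous_real continuous_intros)
  have C0: "C \<ge> 0" unfolding C_def by (intro integral_nonneg intc) simp
  have var: "0 \<le> h * D + h\<^sup>2 * C" for h
  proof -
    have sl: "multiplier (a + h * \<alpha>) (b + h * \<beta>) x = ?p x + h * ?m x" for x
      by (simp add: multiplier_def algebra_simps)
    have "((\<lambda>x. ?s x + h * ?v x + h\<^sup>2 * ?c x) has_integral
        (integral {0..X} ?s + h * integral {0..X} ?v + h\<^sup>2 * C)) {0..X}"
      unfolding C_def
      by (intro has_integral_add has_integral_mult_right integrable_integral ints intv intc)
    moreover have "(\<lambda>x. sqrt (1 + (multiplier (a + h * \<alpha>) (b + h * \<beta>) x)\<^sup>2)) integrable_on {0..X}"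
      by (intro integrable_continuous_real continuous_intros)
    ultimately have "integral {0..X} (\<lambda>x. sqrt (1 + (multiplier (a + h * \<alpha>) (b + h * \<beta>) x)\<^sup>2))
        \<le> integral {0..X} ?s + h * integral {0..X} ?v + h\<^sup>2 * C"
    proof (intro has_integral_le[OF integrable_integral])
      fix x
      show "sqrt (1 + (multiplier (a + h * \<alpha>) (b + h * \<beta>) x)\<^sup>2) \<le> ?s x + h * ?v x + h\<^sup>2 * ?c x"
        using sqrt_one_plus_square_upper_parabola[of "?p x" "h * ?m x"]
        unfolding sl by (simp add: power_mult_distrib mult_ac)
    qed
    moreover have "dual_function X Y Z a b \<le> dual_function X Y Z (a + h * \<alpha>) (b + h * \<beta>)" by (rule min)
    ultimately show ?thesis by (simp add: dual_function_def D_def algebra_simps)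
  qed
  have "D = 0"
  proof -
    \<comment> \<open>Testing with \<open>h = - D / (C + 1)\<close> instead of \<open>- D / C\<close> also covers \<open>C = 0\<close>.\<close>
    define c where "c = C + 1"
    have c: "c > 0" using C0 by (simp add: c_def)
    have "0 \<le> (- D / c) * D + (- D / c)\<^sup>2 * (c - 1)"
      using var[of "- D / c"] by (simp add: c_def)
    also have "\<dots> = - ((D / c)\<^sup>2)" using c by (simp add: field_simps power2_eq_square)
    finally show ?thesis using c by simp
  qed
  then show ?thesis by (simp add: D_def)
qed

section \<open>Behaviour of the dual function at infinity\<close>

lemma recession_scale:
  assumes "0 \<le> c"
  shows "recession_function X Y Z (c * a) (c * b) = c * recession_function X Y Z a b"
proof -
  have "\<bar>multiplier (c * a) (c * b) x\<bar> = c * \<bar>multiplier a b x\<bar>" for x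
  proof -
    have "multiplier (c * a) (c * b) x = c * multiplier a b x" by (simp add: multiplier_def algebra_simps)
    then show ?thesis using assms by (simp add: abs_mult)
  qed
  then show ?thesis by (simp add: recession_function_def algebra_simps)
qed

lemma recession_le_dual: "recession_function X Y Z a b \<le> dual_function X Y Z a b"
proof -
  have "integral {0..X} (\<lambda>x. \<bar>multiplier a b x\<bar>) \<le> integral {0..X} (\<lambda>x. sqrt (1 + (multiplier a b x)\<^sup>2))"
    by (intro integral_le integrable_continuous_real continuous_intros) (simp add: real_le_rsqrt)
  then show ?thesis by (simp add: recession_function_def dual_function_def)
qed

lemma continuous_on_dual: "continuous_on S (\<lambda>c. dual_function X Y Z (fst c) (snd c))"
proof -
  have "continuous_on S (\<lambda>c. integral (cbox 0 X) (\<lambda>x. sqrt (1 + (multiplier (fst c) (snd c) x)\<^sup>2)))"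
    by (rule integral_continuous_on_param) (auto simp: split_beta intro!: continuous_intros)
  then show ?thesis unfolding dual_function_def by (auto intro!: continuous_intros)
qed

lemma continuous_on_recession: "continuous_on S (\<lambda>c. recession_function X Y Z (fst c) (snd c))"
proof -
  have "continuous_on S (\<lambda>c. integral (cbox 0 X) (\<lambda>x. \<bar>multiplier (fst c) (snd c) x\<bar>))"
    by (rule integral_continuous_on_param) (auto simp: split_beta intro!: continuous_intros)
  then show ?thesis unfolding recession_function_def by (auto intro!: continuous_intros)
qed

text \<open>By compactness the recession function has a positive minimum on the unit circle; as it is
  positively homogeneous and lies below the dual function, the latter grows at least linearly in
  every direction and attains its infimum on a large disc.\<close>

lemma dual_attains_minimum:
  assumes pos: "\<And>a b. (a, b) \<noteq> (0, 0) \<Longrightarrow> 0 < recession_function X Y Z a b"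
  shows "\<exists>a b. \<forall>a' b'. dual_function X Y Z a b \<le> dual_function X Y Z a' b'"
proof -
  let ?G = "\<lambda>c. dual_function X Y Z (fst c) (snd c)" and ?R = "\<lambda>c. recession_function X Y Z (fst c) (snd c)"
  let ?S = "sphere (0 :: real \<times> real) 1"
  have "(1, 0) \<in> ?S" by (simp add: norm_Pair)
  then have "\<exists>e\<in>?S. \<forall>c\<in>?S. ?R e \<le> ?R c"
    by (intro continuous_attains_inf continuous_on_recession) auto
  then obtain e where e: "norm e = 1" "\<And>c. norm c = 1 \<Longrightarrow> ?R e \<le> ?R c"
    by (metis dist_0_norm mem_sphere)
  have "e \<noteq> (0, 0)" using e(1) by (auto simp: norm_Pair)
  then have Re: "0 < ?R e" using pos[of "fst e" "snd e"] by simp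
  have coercive: "norm c * ?R e \<le> ?G c" if "c \<noteq> 0" for c
  proof -
    define c' where "c' = c /\<^sub>R norm c"
    have c_components: "fst c = norm c * fst c'" "snd c = norm c * snd c'"
      using that by (simp_all add: c'_def)
    have "norm c' = 1" using that by (simp add: c'_def)
    then have "norm c * ?R e \<le> norm c * ?R c'" by (intro mult_left_mono e(2)) auto
    also have "\<dots> = ?R c"
      using recession_scale[of "norm c" X Y Z "fst c'" "snd c'"]
      by (simp flip: c_components)
    also have "\<dots> \<le> ?G c" by (rule recession_le_dual)
    finally show ?thesis .
  qed
  define r where "r = \<bar>?G 0\<bar> / ?R e"
  have r0: "0 \<le> r" using Re by (simp add: r_def)
  have "\<exists>m\<in>cball 0 r. \<forall>c\<in>cball 0 r. ?G m \<le> ?G c"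
    using r0 by (intro continuous_attains_inf continuous_on_dual) auto
  then obtain m where m: "\<And>c. norm c \<le> r \<Longrightarrow> ?G m \<le> ?G c"
    by (metis dist_0_norm mem_cball)
  have "?G m \<le> ?G c" for c
  proof (cases "norm c \<le> r")
    case False
    have "?G m \<le> ?G 0" using m[of 0] r0 by simp
    also have "\<dots> \<le> r * ?R e" using Re by (simp add: r_def)
    also have "\<dots> \<le> norm c * ?R e" using False Re by (intro mult_right_mono) auto
    also have "\<dots> \<le> ?G c" using False r0 by (intro coercive) auto
    finally show ?thesis .
  qed (rule m)
  then show ?thesis
    by (intro exI[of _ "fst m"] exI[of _ "snd m"] allI) (metis fst_conv snd_conv)
qed

text \<open>Along the ray through \<open>(a, b)\<close> the dual function at \<open>(n a, n b)\<close> is the integral of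
  \<open>sqrt (1 + n\<^sup>2 m\<^sup>2) - n \<bar>m\<bar>\<close>, where \<open>m\<close> is the multiplier function, plus \<open>n\<close> times the recession
  function.  The integrand is bounded by \<open>1\<close> and tends to \<open>0\<close> except at the at most two zeros of
  \<open>m\<close>, so the integral tends to \<open>0\<close>.\<close>

lemma dual_le_zero_along_ray:
  assumes nz: "(a, b) \<noteq> (0, 0)" and rec: "recession_function X Y Z a b \<le> 0"
    and lower: "\<And>a' b'. l \<le> dual_function X Y Z a' b'"
  shows "l \<le> 0"
proof -
  let ?m = "multiplier a b"
  let ?g = "\<lambda>n x. sqrt (1 + (real n * ?m x)\<^sup>2) - real n * \<bar>?m x\<bar>"
  let ?N = "{x. ?m x = 0}"
  let ?D = "\<lambda>n x. if x \<in> ?N then 0 else ?g n x"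
  have "finite ?N"
  proof (cases "b = 0")
    case True
    then show ?thesis using nz by (simp add: multiplier_def)
  next
    case False
    have "?N \<subseteq> {sqrt (- 2 * a / b), - sqrt (- 2 * a / b)}"
    proof
      fix x assume "x \<in> ?N"
      then have "x\<^sup>2 = - 2 * a / b" using False by (simp add: multiplier_def field_simps)
      then have "\<bar>x\<bar> = sqrt (- 2 * a / b)" by (metis real_sqrt_abs)
      then show "x \<in> {sqrt (- 2 * a / b), - sqrt (- 2 * a / b)}" by (auto simp: abs_if split: if_splits)
    qed
    then show ?thesis by (rule finite_subset) simp
  qed
  then have neg: "negligible ?N" by (rule negligible_finite)
  have intg: "?g n integrable_on {0..X}" for n
    by (intro integrable_continuous_real continuous_intros)
  have g_bounds: "0 \<le> ?g n x \<and> ?g n x \<le> 1 \<and> ?g n x * (real n * \<bar>?m x\<bar>) \<le> 1" for n x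
  proof -
    define p where "p = real n * \<bar>?m x\<bar>"
    define s where "s = sqrt (1 + p\<^sup>2)"
    have p: "0 \<le> p" by (simp add: p_def)
    have s: "s\<^sup>2 = 1 + p\<^sup>2" by (simp add: s_def)
    have ps: "p \<le> s" unfolding s_def by (rule real_le_rsqrt) simp
    have s1: "s \<le> 1 + p" unfolding s_def by (rule real_le_lsqrt) (use p in \<open>auto simp: power2_sum\<close>)
    have "(s - p) * p \<le> (s - p) * (s + p)" using p ps by (intro mult_left_mono) auto
    also have "\<dots> = 1" using s by (simp add: algebra_simps power2_eq_square)
    finally have "(s - p) * p \<le> 1" .
    moreover have "?g n x = s - p" by (simp add: s_def p_def power_mult_distrib)
    ultimately show ?thesis using ps s1 by (simp add: p_def)
  qed
  have lim: "(\<lambda>n. ?D n x) \<longlonglongrightarrow> 0" for x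
  proof (cases "x \<in> ?N")
    case False
    then have m: "\<bar>?m x\<bar> > 0" by simp
    have bound_lim: "(\<lambda>n. inverse (real n) * inverse \<bar>?m x\<bar>) \<longlonglongrightarrow> 0"
      by (intro tendsto_mult_left_zero lim_inverse_n)
    have upper: "\<forall>\<^sub>F n in sequentially. ?g n x \<le> inverse (real n) * inverse \<bar>?m x\<bar>"
      using eventually_gt_at_top[of 0]
    proof eventually_elim
      case (elim n)
      then show ?case using g_bounds[of n x] m by (simp add: field_simps)
    qed
    have "\<forall>\<^sub>F n in sequentially. 0 \<le> ?g n x"
      using g_bounds by simp
    from tendsto_sandwich[OF this upper tendsto_const bound_lim]
    have "(\<lambda>n. ?g n x) \<longlonglongrightarrow> 0" .
    then show ?thesis using False by simp
  qed simp
  have intD: "(?D n has_integral integral {0..X} (?g n)) {0..X}" for n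
    by (rule has_integral_spike[OF neg _ integrable_integral[OF intg]]) simp
  have "(\<lambda>n. integral {0..X} (?D n)) \<longlonglongrightarrow> integral {0..X} (\<lambda>_. 0)"
    using intD g_bounds lim
    by (intro dominated_convergence(2)[where h = "\<lambda>_. 1"]) (auto simp: has_integral_integrable)
  then have "(\<lambda>n. integral {0..X} (?g n)) \<longlonglongrightarrow> 0"
    using integral_unique[OF intD] by simp
  moreover have "l \<le> integral {0..X} (?g n)" for n
  proof -
    have sl: "multiplier (real n * a) (real n * b) x = real n * ?m x" for x
      by (simp add: multiplier_def algebra_simps)
    have "l \<le> dual_function X Y Z (real n * a) (real n * b)" by (rule lower)
    also have "\<dots> = integral {0..X} (\<lambda>x. sqrt (1 + (real n * ?m x)\<^sup>2)) - real n * (a * Y + b * Z)"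
      unfolding dual_function_def sl by (simp add: algebra_simps)
    also have "\<dots> = integral {0..X} (?g n) + real n * recession_function X Y Z a b"
    proof -
      have "integral {0..X} (?g n) = integral {0..X} (\<lambda>x. sqrt (1 + (real n * ?m x)\<^sup>2))
          - integral {0..X} (\<lambda>x. real n * \<bar>?m x\<bar>)"
        by (intro Henstock_Kurzweil_Integration.integral_diff integrable_continuous_real
            continuous_intros)
      then show ?thesis by (simp add: recession_function_def algebra_simps)
    qed
    also have "\<dots> \<le> integral {0..X} (?g n)"
      using rec by (simp add: mult_nonneg_nonpos)
    finally show ?thesis .
  qed
  ultimately show ?thesis by (intro LIMSEQ_le_const) auto
qed

section \<open>Existence of optimal trajectories\<close>

lemma traj_length_nonneg: "admissible T q u \<Longrightarrow> 0 \<le> traj_length T u"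
  unfolding traj_length_def
proof (intro integral_nonneg_AE AE_I2)
  fix t assume "admissible T q u" "t \<in> space (lebesgue_on {0..T})"
  then have "\<bar>snd (u t)\<bar> \<le> fst (u t)"
    by (force simp: admissible_def U2_def image_subset_iff split: prod.splits)
  then show "0 \<le> sqrt ((fst (u t))\<^sup>2 - (snd (u t))\<^sup>2)"
    using power_mono[of "\<bar>snd (u t)\<bar>" "fst (u t)" 2] by auto
qed

theorem theorem11:
  fixes q0 q1 :: point
  assumes "q0 = (0, 0, 0)"
    and "q1 \<in> attainable_set q0"
  shows "\<exists>t1 q u. optimal q0 q1 t1 q u"
proof -
  obtain X Y Z where q1: "q1 = (X, Y, Z)" by (cases q1)
  obtain T q u where adm: "admissible T q u" and con: "connects T q (0, 0, 0) (X, Y, Z)"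
    using assms by (auto simp: attainable_set_def q1)
  show ?thesis
  proof (cases "\<exists>a b. (a, b) \<noteq> (0, 0) \<and> recession_function X Y Z a b \<le> 0")
    case True
    \<comment> \<open>Degenerate case: all lengths vanish, so the given trajectory is already optimal.\<close>
    then obtain a b where ab: "(a, b) \<noteq> (0, 0)" "recession_function X Y Z a b \<le> 0" by blast
    have "traj_length T' u' \<le> traj_length T u"
      if "admissible T' q' u'" "connects T' q' (0, 0, 0) (X, Y, Z)" for T' q' u'
    proof -
      have "traj_length T' u' \<le> 0"
        using ab by (rule dual_le_zero_along_ray) (rule traj_length_le_dual[OF that])
      also have "0 \<le> traj_length T u" by (rule traj_length_nonneg[OF adm])
      finally show ?thesis .
    qed
    then have "optimal q0 q1 T q u"
      using adm con by (auto simp: optimal_def assms(1) q1)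
    then show ?thesis by blast
  next
    case False
    then have "\<exists>a b. \<forall>a' b'. dual_function X Y Z a b \<le> dual_function X Y Z a' b'"
      by (intro dual_attains_minimum) (meson not_le)
    then obtain a b where min: "\<And>a' b'. dual_function X Y Z a b \<le> dual_function X Y Z a' b'" by blast
    have X: "0 \<le> X" using admissible_x_mono[OF adm] con by (simp add: connects_def)
    have "integral {0..X} (\<lambda>x. multiplier a b x / sqrt (1 + (multiplier a b x)\<^sup>2)) = Y"
      using dual_stationary[OF min, of 1 0] by (simp add: multiplier_def[of 1 0])
    moreover have "integral {0..X} (\<lambda>x. multiplier a b x / sqrt (1 + (multiplier a b x)\<^sup>2) * (x\<^sup>2 / 2)) = Z"
      using dual_stationary[OF min, of 0 1] by (simp add: multiplier_def[of 0 1])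
    ultimately obtain q' u' where *: "admissible X q' u'" "connects X q' (0, 0, 0) (X, Y, Z)"
      "traj_length X u' = dual_function X Y Z a b"
      using dual_attained_by_trajectory[OF X] by blast
    then have "optimal q0 q1 X q' u'"
      using traj_length_le_dual by (auto simp: optimal_def assms(1) q1)
    then show ?thesis by blast
  qed
qed

end
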